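(* There exists an oracle $A$ and an $A$-scalable set $B$ such that $\mathrm{census}_B\notin\mathrm{FP}^A$.
   Context: Strings are over $\Sigma=\{0,1\}$, with $\le$ the standard lexicographic order. $\mathrm{census}_B(1^n)=|\{x\in B:|x|=n\}|$. A set is rankable in $\mathrm{FP}^X$ if its ranking function $x\mapsto|\{y\le x:y\in$ set$\}|$ is computable by a deterministic polynomial-time oracle transducer with oracle $X$. A $\mathrm{P}^X$-isomorphism is a bijection $\phi:\Sigma^*\to\Sigma^*$ with $\phi,\phi^{-1}\in\mathrm{FP}^X$. A set is $X$-scalable if there is a $\mathrm{P}^X$-isomorphism mapping it onto some set rankable in $\mathrm{FP}^X$. *)

theory Defs
  imports
    "HOL-Computational_Algebra.Polynomial"
    "HOL-Library.Finite_Map"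
    "HOL-Library.List_Lenlexorder"
begin

text \<open>
  Strings over \<open>{0,1}\<close> are of type \<^typ>\<open>bool list\<close>; the order \<open>\<le>\<close> on them is the one of
  \<open>List_Lenlexorder\<close> (shorter strings first, then lexicographically, \<open>False < True\<close>). This is the
  order called lexicographic in complexity theory; ranking functions need it, as in the dictionary
  order a string may have infinitely many predecessors.
\<close>

subsection \<open>Deterministic oracle transducers\<close>

text \<open>
  A machine has a two-way read-only input tape, a two-way infinite work tape, a one-way write-only
  query tape and a one-way write-only output tape. States and work symbols are natural numbers;
  \<open>0\<close> is the initial state and \<open>0\<close> is the blank work symbol. The program is a finite table
  indexed by the state, the scanned input symbol (\<open>None\<close> outside the input) and the scanned work
  symbol, so only finitely many states and work symbols are ever used. The machine halts when the
  table has no applicable entry.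

  \<open>Act q a dw di u v\<close> enters state \<open>q\<close>, writes \<open>a\<close> on the work tape, moves the work head by \<open>dw\<close> and
  the input head by \<open>di\<close>, and appends \<open>u\<close> to the query tape and \<open>v\<close> to the output tape
  (\<open>None\<close> appends nothing).
  \<open>Ask q r\<close> asks whether the content of the query tape belongs to the oracle, enters \<open>q\<close> if it does
  and \<open>r\<close> if it does not, and erases the query tape. Either instruction costs one step.
\<close>

datatype dir = Lft | Stay | Rgt

datatype instr =
    Act nat nat dir dir "bool option" "bool option"
  | Ask nat nat

type_synonym transducer = "(nat \<times> bool option \<times> nat, instr) fmap"

record config =
  cstate :: nat
  ihead :: int
  wtape :: "int \<Rightarrow> nat"
  whead :: int
  qtape :: "bool list"
  otape :: "bool list"

definition init_config :: config where
  "init_config = \<lparr>cstate = 0, ihead = 0, wtape = (\<lambda>_. 0), whead = 0, qtape = [], otape = []\<rparr>"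

fun move :: "dir \<Rightarrow> int \<Rightarrow> int" where
  "move Lft i = i - 1"
| "move Stay i = i"
| "move Rgt i = i + 1"

definition input_symbol :: "bool list \<Rightarrow> int \<Rightarrow> bool option" where
  "input_symbol x i = (if 0 \<le> i \<and> i < int (length x) then Some (x ! nat i) else None)"

fun append_opt :: "bool list \<Rightarrow> bool option \<Rightarrow> bool list" where
  "append_opt w None = w"
| "append_opt w (Some b) = w @ [b]"

definition current_instr :: "transducer \<Rightarrow> bool list \<Rightarrow> config \<Rightarrow> instr option" where
  "current_instr M x c =
     fmlookup M (cstate c, input_symbol x (ihead c), wtape c (whead c))"

definition halted :: "transducer \<Rightarrow> bool list \<Rightarrow> config \<Rightarrow> bool" where
  "halted M x c \<longleftrightarrow> current_instr M x c = None"

definition step :: "transducer \<Rightarrow> bool list set \<Rightarrow> bool list \<Rightarrow> config \<Rightarrow> config" where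
  "step M X x c =
     (case current_instr M x c of
        None \<Rightarrow> c
      | Some (Act q a dw di u v) \<Rightarrow>
          \<lparr>cstate = q,
           ihead = move di (ihead c),
           wtape = (wtape c)(whead c := a),
           whead = move dw (whead c),
           qtape = append_opt (qtape c) u,
           otape = append_opt (otape c) v\<rparr>
      | Some (Ask q r) \<Rightarrow>
          c\<lparr>cstate := (if qtape c \<in> X then q else r), qtape := []\<rparr>)"

definition outputs_within ::
    "transducer \<Rightarrow> bool list set \<Rightarrow> bool list \<Rightarrow> nat \<Rightarrow> bool list \<Rightarrow> bool" where
  "outputs_within M X x t y \<longleftrightarrow>
     (let c = (step M X x ^^ t) init_config in halted M x c \<and> otape c = y)"

subsection \<open>Functions computable in polynomial time relative to an oracle\<close>

text \<open>
  \<open>FP X e d\<close> is the class \<open>FP\<close> relative to the oracle \<open>X\<close>, for functions whose arguments and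
  values are presented as strings by the encodings \<open>e\<close> and \<open>d\<close>. For string functions both are
  \<^const>\<open>id\<close>. Nothing is required of the machine on strings outside the range of \<open>e\<close>.
\<close>

definition FP ::
    "bool list set \<Rightarrow> ('a \<Rightarrow> bool list) \<Rightarrow> ('b \<Rightarrow> bool list) \<Rightarrow> ('a \<Rightarrow> 'b) set" where
  "FP X e d =
     {f. \<exists>(M :: transducer) (p :: nat poly). \<forall>a.
           outputs_within M X (e a) (poly p (length (e a))) (d (f a))}"

definition unary :: "nat \<Rightarrow> bool list" where
  "unary n = replicate n True"

text \<open>Most significant bit first, without leading zeros; zero is the one-letter string \<open>0\<close>.\<close>

fun binary :: "nat \<Rightarrow> bool list" where
  "binary n = (if n < 2 then [n = 1] else binary (n div 2) @ [odd n])"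

declare binary.simps [simp del]

subsection \<open>Census, rankability and scalability\<close>

definition census :: "bool list set \<Rightarrow> nat \<Rightarrow> nat" where
  "census B n = card {x \<in> B. length x = n}"

definition rank :: "bool list set \<Rightarrow> bool list \<Rightarrow> nat" where
  "rank S x = card {y. y \<le> x \<and> y \<in> S}"

definition rankable :: "bool list set \<Rightarrow> bool list set \<Rightarrow> bool" where
  "rankable X S \<longleftrightarrow> rank S \<in> FP X id binary"

definition P_isomorphism :: "bool list set \<Rightarrow> (bool list \<Rightarrow> bool list) \<Rightarrow> bool" where
  "P_isomorphism X \<phi> \<longleftrightarrow> bij \<phi> \<and> \<phi> \<in> FP X id id \<and> inv \<phi> \<in> FP X id id"

definition scalable :: "bool list set \<Rightarrow> bool list set \<Rightarrow> bool" where
  "scalable X B \<longleftrightarrow> (\<exists>\<phi> S. P_isomorphism X \<phi> \<and> rankable X S \<and> \<phi> ` B = S)"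

end

theory Submission
  imports Defs "HOL-Library.Countable_Set" "HOL-Real_Asymp.Real_Asymp"
begin

text \<open>
  The strings ending in 0 are rankable: counting the strings up to \<open>x\<close> gives the number written
  \<open>1x\<close> in binary, so the rank of \<open>xb\<close> is \<open>1x\<close>. For an oracle \<open>A\<close> all of whose strings end in 0, the
  involution that swaps \<open>z\<close> with \<open>z1\<close> for every \<open>z \<in> A\<close> is computable with \<open>A\<close>, and its inverse image
  \<open>B\<close> of the set of strings ending in 0 is therefore scalable. Adding to \<open>A\<close> a string
  \<open>z\<close> longer than all others lowers the census of \<open>B\<close> at \<open>|z|\<close> by one, but a machine working
  on a unary input has no time to find \<open>z\<close>. Diagonalising over all machines with polynomial clocks
  gives the oracle.
\<close>

section \<open>Running transducers\<close>

text \<open>An arbitrary start configuration lets a run be cut after its first step, so that loops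
  can be treated by induction on the unread input.\<close>

definition outputs_from ::
    "transducer \<Rightarrow> bool list set \<Rightarrow> bool list \<Rightarrow> config \<Rightarrow> nat \<Rightarrow> bool list \<Rightarrow> bool" where
  "outputs_from M X x c t y \<longleftrightarrow>
     halted M x ((step M X x ^^ t) c) \<and> otape ((step M X x ^^ t) c) = y"

lemma outputs_within_iff: "outputs_within M X x t y \<longleftrightarrow> outputs_from M X x init_config t y"
  by (simp add: outputs_within_def outputs_from_def Let_def)

lemma outputs_from_Suc:
  "outputs_from M X x c (Suc t) y \<longleftrightarrow> outputs_from M X x (step M X x c) t y"
  by (simp add: outputs_from_def funpow_Suc_right del: funpow.simps)

text \<open>A halted configuration is a fixed point of \<open>step\<close>, so surplus time does no
  harm and time bounds need not be exact.\<close>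

lemma outputs_from_halted:
  assumes "halted M x c" "otape c = y"
  shows "outputs_from M X x c t y"
proof -
  have "step M X x c = c"
    using assms(1) by (simp add: step_def halted_def)
  then have "(step M X x ^^ t) c = c"
    by (induction t) simp_all
  then show ?thesis
    using assms by (simp add: outputs_from_def)
qed

lemma step_cong:
  assumes "qtape c \<in> X \<longleftrightarrow> qtape c \<in> Y"
  shows "step M X x c = step M Y x c"
  using assms by (simp add: step_def split: option.split instr.split)

text \<open>The queries are only examined along the run with \<open>X\<close>: as long as the
  answers agree, the run with \<open>Y\<close> is the same run and poses the same queries.\<close>

lemma run_cong:
  assumes "\<And>s. s < t \<Longrightarrow> qtape ((step M X x ^^ s) c) \<in> X \<longleftrightarrow> qtape ((step M X x ^^ s) c) \<in> Y"
  shows "(step M X x ^^ t) c = (step M Y x ^^ t) c"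
  using assms
proof (induction t)
  case (Suc t)
  have "(step M X x ^^ t) c = (step M Y x ^^ t) c"
    using Suc.prems by (intro Suc.IH) simp
  then show ?case
    using step_cong[OF Suc.prems[of t]] by simp
qed simp

lemma length_qtape_step: "length (qtape (step M X x c)) \<le> Suc (length (qtape c))"
proof -
  have "length (append_opt w u) \<le> Suc (length w)" for w u
    by (cases u) simp_all
  then show ?thesis
    by (simp add: step_def split: option.split instr.split)
qed

lemma length_qtape_run: "length (qtape ((step M X x ^^ t) init_config)) \<le> t"
proof (induction t)
  case (Suc t)
  then show ?case
    using length_qtape_step[of M X x "(step M X x ^^ t) init_config"] by simp
qed (simp add: init_config_def)

text \<open>The query tape grows by at most one letter per step, so a run of \<open>t\<close> steps
  never asks about a string longer than \<open>t\<close>.\<close>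

lemma outputs_within_local:
  assumes "\<And>w. length w \<le> t \<Longrightarrow> w \<in> X \<longleftrightarrow> w \<in> Y"
  shows "outputs_within M X x t y \<longleftrightarrow> outputs_within M Y x t y"
proof -
  have "(step M X x ^^ t) init_config = (step M Y x ^^ t) init_config"
  proof (rule run_cong)
    fix s assume "s < t"
    then have "length (qtape ((step M X x ^^ s) init_config)) \<le> t"
      using length_qtape_run[of s M X x] by simp
    then show "qtape ((step M X x ^^ s) init_config) \<in> X \<longleftrightarrow>
        qtape ((step M X x ^^ s) init_config) \<in> Y"
      by (rule assms)
  qed
  then show ?thesis
    by (simp add: outputs_within_def)
qed

lemma outputs_within_unique:
  "outputs_within M X x t y \<Longrightarrow> outputs_within M X x t y' \<Longrightarrow> y = y'"
  by (auto simp: outputs_within_def Let_def)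

text \<open>Both machines below make one pass over the input and never use the work tape;
  \<open>u\<close> is the prefix already read.\<close>

abbreviation scan_config :: "nat \<Rightarrow> bool list \<Rightarrow> bool list \<Rightarrow> bool list \<Rightarrow> config" where
  "scan_config q u w v \<equiv> \<lparr>cstate = q, ihead = int (length u), wtape = (\<lambda>_. 0), whead = 0,
     qtape = w, otape = v\<rparr>"

lemma const_fun_upd [simp]: "(\<lambda>_. a)(i := a) = (\<lambda>_. a)"
  by auto

lemma input_symbol_append_Nil [simp]: "input_symbol u (int (length u)) = None"
  by (simp add: input_symbol_def)

lemma input_symbol_append_Cons [simp]: "input_symbol (u @ b # v) (int (length u)) = Some b"
  by (simp add: input_symbol_def)

section \<open>Ranking the strings that end in zero\<close>

text \<open>The number with binary numeral \<open>1x\<close>, which is also the position of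
  \<open>x\<close> among all strings, counted from 1.\<close>

definition index :: "bool list \<Rightarrow> nat" where
  "index = foldl (\<lambda>a b. 2 * a + of_bool b) 1"

lemma index_Nil [simp]: "index [] = 1"
  by (simp add: index_def)

lemma index_snoc [simp]: "index (x @ [b]) = 2 * index x + of_bool b"
  by (simp add: index_def)

lemma index_pos: "0 < index x"
  by (induction x rule: rev_induct) simp_all

lemma binary_index: "binary (index x) = True # x"
proof (induction x rule: rev_induct)
  case Nil
  show ?case by (simp add: binary.simps)
next
  case (snoc b x)
  have "\<not> 2 * index x + of_bool b < 2"
    using index_pos[of x] by simp
  then show ?case
    using snoc by (subst binary.simps) simp
qed

lemma index_surj: "0 < n \<Longrightarrow> \<exists>x. index x = n"
proof (induction n rule: less_induct)
  case (less n)
  show ?case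
  proof (cases "n = 1")
    case True
    then show ?thesis using index_Nil by blast
  next
    case False
    with less.prems obtain x where "index x = n div 2"
      using less.IH[of "n div 2"] by auto
    then have "index (x @ [odd n]) = n"
      by (simp add: of_bool_def)
    then show ?thesis ..
  qed
qed

text \<open>Positive numbers have numerals starting with 1 and zero does not; on positive numbers
  the numeral determines the string \<open>x\<close> with that \<open>index\<close>. Injectivity
  later turns different censuses into different outputs.\<close>

lemma inj_binary: "inj binary"
proof
  fix m n assume eq: "binary m = binary n"
  have zero: "binary 0 = [False]"
    by (simp add: binary.simps)
  have pos: "\<exists>x. index x = k \<and> binary k = True # x" if "0 < k" for k
    using index_surj[OF that] binary_index by blast
  show "m = n"
    using pos[of m] pos[of n] eq zero by (cases "m = 0"; cases "n = 0") auto
qed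

lemma index_bounds: "2 ^ length x \<le> index x \<and> index x < 2 ^ Suc (length x)"
  by (induction x rule: rev_induct) (auto simp: of_bool_def)

text \<open>From \<open>a < b\<close> follows \<open>2 * a + 1 < 2 * b\<close>, so later digits
  cannot reverse the order of the accumulators.\<close>

lemma foldl_binary_mono:
  assumes "length x = length y" "a < b"
  shows "foldl (\<lambda>a b. 2 * a + of_bool b) (a :: nat) x < foldl (\<lambda>a b. 2 * a + of_bool b) b y"
  using assms by (induction x y arbitrary: a b rule: list_induct2) (auto simp: of_bool_def)

lemma foldl_binary_less:
  assumes "length x = length y" "x < y"
  shows "foldl (\<lambda>a b. 2 * a + of_bool b) (a :: nat) x < foldl (\<lambda>a b. 2 * a + of_bool b) a y"
  using assms
  by (induction x y arbitrary: a rule: list_induct2)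
    (auto simp: Cons_less_Cons intro: foldl_binary_mono)

lemma index_less: "x < y \<Longrightarrow> index x < index y"
proof -
  assume less: "x < y"
  show ?thesis
  proof (cases "length x = length y")
    case True
    with less show ?thesis
      unfolding index_def by (intro foldl_binary_less)
  next
    case False
    with less have "length x < length y"
      by (auto simp: list_less_def lenlex_conv)
    \<comment> \<open>Strings of different lengths have indices in disjoint dyadic intervals,
      ordered by length.\<close>
    then have "(2::nat) ^ Suc (length x) \<le> 2 ^ length y"
      by (intro power_increasing) auto
    then show ?thesis
      using index_bounds[of x] index_bounds[of y] by linarith
  qed
qed

lemma index_le_iff: "index x \<le> index y \<longleftrightarrow> x \<le> y"
  by (metis index_less leD le_less linear)

lemma card_atMost_string: "card {y. y \<le> x} = index x"
proof -
  have "inj index"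
    by (rule injI) (metis index_le_iff order.antisym order.refl)
  then have "card {y. y \<le> x} = card (index ` {y. y \<le> x})"
    by (simp add: card_image inj_on_subset)
  also have "index ` {y. y \<le> x} = {1..index x}"
  proof
    show "index ` {y. y \<le> x} \<subseteq> {1..index x}"
      using index_pos by (auto simp: index_le_iff Suc_le_eq)
    show "{1..index x} \<subseteq> index ` {y. y \<le> x}"
    proof
      fix n assume n: "n \<in> {1..index x}"
      then obtain y where "index y = n"
        using index_surj[of n] by auto
      with n show "n \<in> index ` {y. y \<le> x}"
        by (auto simp: index_le_iff)
    qed
  qed
  finally show ?thesis by simp
qed

section \<open>The rank function and its machine\<close>

definition zero_ending :: "bool list set" where
  "zero_ending = range (\<lambda>w. w @ [False])"

lemma snoc_in_zero_ending [simp]: "w @ [b] \<in> zero_ending \<longleftrightarrow> \<not> b"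
  by (auto simp: zero_ending_def)

lemma Nil_notin_zero_ending [simp]: "[] \<notin> zero_ending"
  by (auto simp: zero_ending_def)

lemma rank_zero_ending_Nil: "rank zero_ending [] = 0"
proof -
  have "{y. y \<le> [] \<and> y \<in> zero_ending} = {}"
    by auto
  then show ?thesis unfolding rank_def by simp
qed

text \<open>The last letter \<open>b\<close> does not matter:
  \<open>2 * index w \<le> 2 * index x + of_bool b\<close> is equivalent to
  \<open>index w \<le> index x\<close>.\<close>

lemma rank_zero_ending_snoc: "rank zero_ending (x @ [b]) = index x"
proof -
  have "w @ [False] \<le> x @ [b] \<longleftrightarrow> w \<le> x" for w
    unfolding index_le_iff[symmetric] by (auto simp: of_bool_def)
  then have "{y. y \<le> x @ [b] \<and> y \<in> zero_ending} = (\<lambda>w. w @ [False]) ` {w. w \<le> x}"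
    by (auto simp: zero_ending_def)
  then show ?thesis
    by (simp add: rank_def card_image inj_on_def card_atMost_string)
qed


text \<open>Copying the input with a delay of one letter drops the last letter.\<close>

definition rank_machine :: transducer where
  "rank_machine = fmap_of_list
     [((0, None, 0), Act 3 0 Stay Stay None (Some False)),
      ((0, Some False, 0), Act 1 0 Stay Rgt None (Some True)),
      ((0, Some True, 0), Act 2 0 Stay Rgt None (Some True)),
      ((1, Some False, 0), Act 1 0 Stay Rgt None (Some False)),
      ((1, Some True, 0), Act 2 0 Stay Rgt None (Some False)),
      ((2, Some False, 0), Act 1 0 Stay Rgt None (Some True)),
      ((2, Some True, 0), Act 2 0 Stay Rgt None (Some True))]"

text \<open>State 1 or 2 holds back the last letter \<open>b\<close> read. At the end of the input
  it is never written, which leaves the numeral of the rank.\<close>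

lemma rank_machine_loop:
  assumes "length v \<le> t"
  shows "outputs_from rank_machine X (u @ b # v) (scan_config (if b then 2 else 1) (u @ [b]) [] (True # u))
    t (True # butlast (u @ b # v))"
  using assms
proof (induction v arbitrary: u b t)
  case Nil
  show ?case
    using input_symbol_append_Nil[of "u @ [b]"]
    by (intro outputs_from_halted)
      (auto simp: halted_def current_instr_def rank_machine_def fmlookup_of_list)
next
  case (Cons c v)
  from Cons.prems obtain t' where t: "t = Suc t'" "length v \<le> t'"
    by (cases t) auto
  have "step rank_machine X (u @ b # c # v) (scan_config (if b then 2 else 1) (u @ [b]) [] (True # u)) =
      scan_config (if c then 2 else 1) ((u @ [b]) @ [c]) [] (True # u @ [b])"
    using input_symbol_append_Cons[of "u @ [b]" c v]
    by (cases b; cases c)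
      (simp_all add: step_def current_instr_def rank_machine_def fmlookup_of_list)
  then show ?case
    unfolding t(1) using Cons.IH[OF t(2), of "u @ [b]" c]
    by (subst outputs_from_Suc) simp
qed

lemma rankable_zero_ending: "rankable X zero_ending"
proof -
  \<comment> \<open>The constant 1 pays for the empty input, on which one step writes the numeral of
    zero.\<close>
  have "outputs_within rank_machine X x (poly [:1, 1:] (length x)) (binary (rank zero_ending x))" for x
  proof (cases x)
    case Nil
    have "step rank_machine X [] init_config = scan_config 3 [] [] [False]"
      using input_symbol_append_Nil[of "[]"]
      by (simp add: init_config_def step_def current_instr_def rank_machine_def fmlookup_of_list)
    moreover have "outputs_from rank_machine X [] (scan_config 3 [] [] [False]) 0 [False]"
      by (intro outputs_from_halted)
        (auto simp: halted_def current_instr_def rank_machine_def fmlookup_of_list)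
    ultimately have "outputs_from rank_machine X [] init_config (Suc 0) [False]"
      by (subst outputs_from_Suc) simp
    then show ?thesis
      using Nil by (simp add: outputs_within_iff rank_zero_ending_Nil binary.simps)
  next
    case (Cons b v)
    have "step rank_machine X (b # v) init_config = scan_config (if b then 2 else 1) [b] [] [True]"
      using input_symbol_append_Cons[of "[]" b v]
      by (cases b) (simp_all add: init_config_def step_def current_instr_def rank_machine_def fmlookup_of_list)
    then have "outputs_from rank_machine X (b # v) init_config (Suc (length x)) (True # butlast (b # v))"
      using rank_machine_loop[of v "length x" X "[]" b] Cons
      by (subst outputs_from_Suc) simp
    moreover have "binary (rank zero_ending (b # v)) = True # butlast (b # v)"
      using rank_zero_ending_snoc[of "butlast (b # v)" "last (b # v)"]
      by (simp add: binary_index del: butlast.simps last.simps)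
    ultimately show ?thesis
      using Cons by (simp add: outputs_within_iff)
  qed
  then show ?thesis
    unfolding rankable_def FP_def by (auto intro!: exI[of _ rank_machine] exI[of _ "[:1, 1:]"])
qed

section \<open>Swapping strings of different lengths\<close>

definition flip :: "bool list set \<Rightarrow> bool list \<Rightarrow> bool list" where
  "flip A x = (if x \<in> A then x @ [True]
     else if x \<noteq> [] \<and> last x \<and> butlast x \<in> A then butlast x else x)"

text \<open>Members of \<open>A\<close> end in 0 and their partners in 1, so the swapped pairs are
  disjoint.\<close>

lemma flip_flip:
  assumes "A \<subseteq> zero_ending"
  shows "flip A (flip A x) = x"
proof -
  have "w @ [True] \<notin> A" for w
    using assms by auto
  moreover have "butlast x @ [True] = x" if "x \<noteq> []" "last x"
    using append_butlast_last_id[OF that(1)] that(2) by simp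
  ultimately show ?thesis
    by (auto simp: flip_def)
qed

text \<open>While scanning, states 0, 1 and 2 mean: the prefix read does not end in 0; it ends in 0; it
  ends in 01 and its last letter has not been copied. States 1 and 2 are then ready to ask, at the
  end of the input, whether the pair of the input is swapped.\<close>

definition flip_machine :: transducer where
  "flip_machine = fmap_of_list
     [((0, Some False, 0), Act 1 0 Stay Rgt (Some False) (Some False)),
      ((0, Some True, 0), Act 0 0 Stay Rgt (Some True) (Some True)),
      ((1, Some False, 0), Act 1 0 Stay Rgt (Some False) (Some False)),
      ((1, Some True, 0), Act 2 0 Stay Rgt None None),
      ((1, None, 0), Ask 3 4),
      ((2, Some False, 0), Act 0 0 Stay Stay (Some True) (Some True)),
      ((2, Some True, 0), Act 0 0 Stay Stay (Some True) (Some True)),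
      ((2, None, 0), Ask 4 3),
      ((3, None, 0), Act 4 0 Stay Stay None (Some True))]"

lemma flip_machine_stop:
  "outputs_from flip_machine X x (scan_config 4 x [] w) t w"
  by (intro outputs_from_halted)
    (auto simp: halted_def current_instr_def flip_machine_def fmlookup_of_list)

lemma flip_machine_append_True:
  "outputs_from flip_machine X x (scan_config 3 x [] w) (Suc t) (w @ [True])"
proof -
  have "step flip_machine X x (scan_config 3 x [] w) = scan_config 4 x [] (w @ [True])"
    by (simp add: step_def current_instr_def flip_machine_def fmlookup_of_list)
  then show ?thesis
    by (subst outputs_from_Suc) (simp add: flip_machine_stop)
qed

text \<open>One induction covers the three scanning states because they lead into each other. State
  0 can hold a prefix ending in 01, but only while a letter remains to be read; hence the side
  condition for \<open>v = []\<close>. The factor 2 pays for the extra step that copies a delayed 1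
  without moving the input head.\<close>

lemma flip_machine_loop:
  assumes A: "A \<subseteq> zero_ending"
  shows "(u \<notin> zero_ending \<and> (v = [] \<longrightarrow> butlast u \<notin> zero_ending) \<longrightarrow> 2 * length v + 2 \<le> t \<longrightarrow>
      outputs_from flip_machine A (u @ v) (scan_config 0 u u u) t (flip A (u @ v))) \<and>
    (u \<in> zero_ending \<longrightarrow> 2 * length v + 2 \<le> t \<longrightarrow>
      outputs_from flip_machine A (u @ v) (scan_config 1 u u u) t (flip A (u @ v))) \<and>
    (u \<in> zero_ending \<longrightarrow> 2 * length v + 3 \<le> t \<longrightarrow>
      outputs_from flip_machine A (u @ True # v) (scan_config 2 (u @ [True]) u u) t
        (flip A (u @ True # v)))"
proof (induction v arbitrary: u t)
  case Nil
  have one: "w @ [True] \<notin> A" for w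
    using A by auto
  show ?case
  proof (intro conjI impI)
    assume u: "u \<notin> zero_ending \<and> ([] = [] \<longrightarrow> butlast u \<notin> zero_ending)"
    then have "flip A u = u"
      using A by (auto simp: flip_def)
    then show "outputs_from flip_machine A (u @ []) (scan_config 0 u u u) t (flip A (u @ []))"
      by (intro outputs_from_halted)
        (auto simp: halted_def current_instr_def flip_machine_def fmlookup_of_list)
  next
    assume u: "u \<in> zero_ending" and t: "2 * length ([] :: bool list) + 2 \<le> t"
    then obtain t' where t': "t = Suc (Suc t')"
      by (cases t; cases "t - 1") auto
    have "step flip_machine A u (scan_config 1 u u u) = scan_config (if u \<in> A then 3 else 4) u [] u"
      by (simp add: step_def current_instr_def flip_machine_def fmlookup_of_list)
    moreover have "flip A u = (if u \<in> A then u @ [True] else u)"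
      using u by (auto simp: flip_def zero_ending_def)
    ultimately show "outputs_from flip_machine A (u @ []) (scan_config 1 u u u) t (flip A (u @ []))"
      unfolding t' using flip_machine_append_True flip_machine_stop
      by (subst outputs_from_Suc) simp
  next
    assume u: "u \<in> zero_ending" and t: "2 * length ([] :: bool list) + 3 \<le> t"
    then obtain t' where t': "t = Suc (Suc t')"
      by (cases t; cases "t - 1") auto
    \<comment> \<open>The query is \<open>u\<close>, not the whole input. A positive answer drops
      the pending 1 and a negative one restores it, so the targets are exchanged compared with state
      1.\<close>
    have "step flip_machine A (u @ [True]) (scan_config 2 (u @ [True]) u u) =
        scan_config (if u \<in> A then 4 else 3) (u @ [True]) [] u"
      using input_symbol_append_Nil[of "u @ [True]"]
      by (simp add: step_def current_instr_def flip_machine_def fmlookup_of_list)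
    moreover have "flip A (u @ [True]) = (if u \<in> A then u else u @ [True])"
      using one by (simp add: flip_def)
    ultimately show "outputs_from flip_machine A (u @ [True]) (scan_config 2 (u @ [True]) u u) t
        (flip A (u @ [True]))"
      unfolding t' using flip_machine_append_True[of A "u @ [True]"] flip_machine_stop[of A "u @ [True]"]
      by (subst outputs_from_Suc) simp
  qed
next
  case (Cons b v)
  \<comment> \<open>State 2 returns to state 0 without consuming \<open>b\<close>, so this case is
    needed for the same remaining input and for a longer prefix, where the induction hypothesis does
    not apply.\<close>
  have copying: "outputs_from flip_machine A (u @ b # v) (scan_config 0 u u u) t (flip A (u @ b # v))"
    if u: "u \<notin> zero_ending" and t: "2 * length (b # v) + 2 \<le> t" for u t
  proof -
    obtain t' where t': "t = Suc t'" "2 * length v + 2 \<le> t'"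
      using t by (cases t) auto
    have "step flip_machine A (u @ b # v) (scan_config 0 u u u) =
        scan_config (if b then 0 else 1) (u @ [b]) (u @ [b]) (u @ [b])"
      by (cases b) (simp_all add: step_def current_instr_def flip_machine_def fmlookup_of_list)
    then show ?thesis
      unfolding t'(1) using Cons.IH[of "u @ [b]" t'] t'(2) u
      by (subst outputs_from_Suc) (cases b; simp)
  qed
  show ?case
  proof (intro conjI impI)
    assume "u \<notin> zero_ending \<and> (b # v = [] \<longrightarrow> butlast u \<notin> zero_ending)"
      and "2 * length (b # v) + 2 \<le> t"
    then show "outputs_from flip_machine A (u @ b # v) (scan_config 0 u u u) t (flip A (u @ b # v))"
      using copying by blast
  next
    assume u: "u \<in> zero_ending" and t: "2 * length (b # v) + 2 \<le> t"
    then obtain t' where t': "t = Suc t'" "2 * length v + 3 \<le> t'"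
      by (cases t) auto
    have "step flip_machine A (u @ b # v) (scan_config 1 u u u) =
        (if b then scan_config 2 (u @ [True]) u u
         else scan_config 1 (u @ [False]) (u @ [False]) (u @ [False]))"
      by (cases b) (simp_all add: step_def current_instr_def flip_machine_def fmlookup_of_list)
    then show "outputs_from flip_machine A (u @ b # v) (scan_config 1 u u u) t (flip A (u @ b # v))"
      unfolding t'(1) using Cons.IH[of "u @ [b]" t'] Cons.IH[of u t'] t'(2) u
      by (subst outputs_from_Suc) (cases b; simp)
  next
    assume "u \<in> zero_ending" and t: "2 * length (b # v) + 3 \<le> t"
    then obtain t' where t': "t = Suc t'" "2 * length (b # v) + 2 \<le> t'"
      by (cases t) auto
    have "step flip_machine A (u @ True # b # v) (scan_config 2 (u @ [True]) u u) =
        scan_config 0 (u @ [True]) (u @ [True]) (u @ [True])"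
      using input_symbol_append_Cons[of "u @ [True]" b v]
      by (cases b) (simp_all add: step_def current_instr_def flip_machine_def fmlookup_of_list)
    then show "outputs_from flip_machine A (u @ True # b # v) (scan_config 2 (u @ [True]) u u) t
        (flip A (u @ True # b # v))"
      unfolding t'(1) using copying[of "u @ [True]" t'] t'(2)
      by (subst outputs_from_Suc) simp
  qed
qed

lemma P_isomorphism_flip:
  assumes "A \<subseteq> zero_ending"
  shows "P_isomorphism A (flip A)"
proof -
  have "outputs_within flip_machine A x (poly [:2, 2:] (length x)) (flip A x)" for x
    using flip_machine_loop[OF assms, of "[]" x "poly [:2, 2:] (length x)"]
    by (simp add: outputs_within_iff init_config_def)
  then have "flip A \<in> FP A id id"
    unfolding FP_def by (auto intro!: exI[of _ flip_machine] exI[of _ "[:2, 2:]"])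
  moreover have "bij (flip A)"
    by (rule o_bij[of "flip A"]) (simp_all add: fun_eq_iff flip_flip[OF assms])
  moreover have "inv (flip A) = flip A"
    by (rule inv_unique_comp) (simp_all add: fun_eq_iff flip_flip[OF assms])
  ultimately show ?thesis
    by (simp add: P_isomorphism_def)
qed

lemma scalable_vimage_flip:
  assumes "A \<subseteq> zero_ending"
  shows "scalable A (flip A -` zero_ending)"
proof -
  have "surj (flip A)"
    using P_isomorphism_flip[OF assms] by (simp add: P_isomorphism_def bij_is_surj)
  then show ?thesis
    unfolding scalable_def
    using P_isomorphism_flip[OF assms] rankable_zero_ending surj_image_vimage_eq by blast
qed

section \<open>Diagonalisation\<close>

abbreviation flip_census :: "bool list set \<Rightarrow> nat \<Rightarrow> nat" where
  "flip_census A \<equiv> census (flip A -` zero_ending)"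

text \<open>The value of \<open>flip\<close> at \<open>x\<close> depends only on the membership of
  \<open>x\<close> and of \<open>butlast x\<close>.\<close>

lemma flip_census_local:
  assumes "\<And>w. length w \<le> n \<Longrightarrow> w \<in> X \<longleftrightarrow> w \<in> Y"
  shows "flip_census X n = flip_census Y n"
proof -
  have "flip X x = flip Y x" if "length x = n" for x
    using assms[of x] assms[of "butlast x"] that by (simp add: flip_def)
  then have "{x \<in> flip X -` zero_ending. length x = n} = {x \<in> flip Y -` zero_ending. length x = n}"
    by auto
  then show ?thesis by (simp add: census_def)
qed

text \<open>Inserting \<open>z\<close> sends it to a string ending in 1, so \<open>z\<close> leaves
  the preimage. The only other string affected is \<open>z\<close> followed by 1, which has a
  different length.\<close>

lemma flip_census_insert:
  assumes "\<And>w. w \<in> F \<Longrightarrow> length w < length z" and z: "z \<in> zero_ending"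
  shows "flip_census (insert z F) (length z) < flip_census F (length z)"
proof -
  have F: "x \<notin> F" if "length x = length z" for x
    using assms(1)[of x] that by auto
  have flip_z: "flip F z = z" "flip (insert z F) z = z @ [True]"
    using z F[of z] by (auto simp: flip_def zero_ending_def)
  have flip_other: "flip (insert z F) x = flip F x" if "length x = length z" "x \<noteq> z" for x
  proof -
    have "butlast x \<noteq> z" if "x \<noteq> []"
      using \<open>length x = length z\<close> that by (cases x rule: rev_cases) auto
    then show ?thesis
      using that by (auto simp: flip_def)
  qed
  have "x \<in> {x \<in> flip (insert z F) -` zero_ending. length x = length z} \<longleftrightarrow>
      x \<in> {x \<in> flip F -` zero_ending. length x = length z} - {z}" for x
    using flip_z flip_other[of x] by (cases "x = z"; cases "length x = length z") simp_all
  then have "{x \<in> flip (insert z F) -` zero_ending. length x = length z} =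
      {x \<in> flip F -` zero_ending. length x = length z} - {z}"
    by (rule set_eqI)
  moreover have "z \<in> {x \<in> flip F -` zero_ending. length x = length z}"
    using z flip_z(1) by simp
  moreover have "finite {x \<in> flip F -` zero_ending. length x = length z}"
    by (rule finite_subset[OF _ finite_lists_length_eq[of UNIV "length z"]]) auto
  ultimately show ?thesis
    unfolding census_def by (simp only: card_Diff1_less)
qed

text \<open>Here \<open>Suc n\<close> will be the length of the unary input and \<open>2 ^ n\<close>
  the number of strings of that length ending in 0. Taking \<open>n\<close> large keeps clear of the
  part of the oracle already fixed.\<close>

lemma poly_less_two_power:
  fixes p :: "nat poly"
  shows "\<exists>n\<ge>m. poly p (Suc n) < 2 ^ n"
proof -
  have "(\<lambda>n. real (Suc n) ^ i / 2 ^ n) \<longlonglongrightarrow> 0" for i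
    by real_asymp
  then have "(\<lambda>n. \<Sum>i\<le>degree p. real (coeff p i) * (real (Suc n) ^ i / 2 ^ n)) \<longlonglongrightarrow>
      (\<Sum>i\<le>degree p. real (coeff p i) * 0)"
    by (intro tendsto_sum tendsto_mult tendsto_const)
  moreover have "(\<Sum>i\<le>degree p. real (coeff p i) * (real (Suc n) ^ i / 2 ^ n)) =
      real (poly p (Suc n)) / 2 ^ n" for n
    by (simp add: poly_altdef sum_divide_distrib del: of_nat_Suc)
  ultimately have "(\<lambda>n. real (poly p (Suc n)) / 2 ^ n) \<longlonglongrightarrow> 0"
    by simp
  then have "eventually (\<lambda>n. real (poly p (Suc n)) / 2 ^ n < 1) sequentially"
    by (rule order_tendstoD) simp
  then have "eventually (\<lambda>n. m \<le> n \<and> real (poly p (Suc n)) / 2 ^ n < 1) sequentially"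
    by (intro eventually_conj eventually_ge_at_top)
  then obtain n where "m \<le> n" "real (poly p (Suc n)) / 2 ^ n < 1"
    using eventually_happens[of _ sequentially] sequentially_bot by fastforce
  then have "real (poly p (Suc n)) < real (2 ^ n)"
    by (simp add: divide_less_eq)
  then show ?thesis
    using \<open>m \<le> n\<close> of_nat_less_iff by blast
qed

text \<open>There are more strings of length \<open>n + 1\<close> ending in 0 than steps, so some such \<open>z\<close> is never
  asked; putting \<open>z\<close> into the oracle changes the census but not the output of \<open>M\<close>.\<close>

lemma defeat_machine:
  fixes p :: "nat poly"
  assumes F: "F \<subseteq> zero_ending" "\<And>w. w \<in> F \<Longrightarrow> length w \<le> m"
  obtains F' n where "F \<subseteq> F'" "F' \<subseteq> zero_ending" "\<And>w. w \<in> F' \<Longrightarrow> w \<in> F \<or> length w > m"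
    "\<And>w. w \<in> F' \<Longrightarrow> length w \<le> n"
    "\<not> outputs_within M F' (unary n) (poly p n) (binary (flip_census F' n))"
proof -
  obtain n where n: "m \<le> n" "poly p (Suc n) < 2 ^ n"
    using poly_less_two_power by blast
  let ?t = "poly p (Suc n)" and ?x = "unary (Suc n)"
  \<comment> \<open>All contents of the query tape along the run, including unfinished queries; even
    so there are at most \<open>?t\<close> of them.\<close>
  let ?Q = "(\<lambda>s. qtape ((step M F ?x ^^ s) init_config)) ` {..<?t}"
  let ?Z = "(\<lambda>w. w @ [False]) ` {w. set w \<subseteq> UNIV \<and> length w = n}"
  have "card ?Q < 2 ^ n"
    using card_image_le[of "{..<?t}" "\<lambda>s. qtape ((step M F ?x ^^ s) init_config)"] n(2) by simp
  also have "2 ^ n = card ?Z"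
    using card_lists_length_eq[of "UNIV :: bool set" n] by (simp add: card_image inj_on_def)
  finally have "\<not> ?Z \<subseteq> ?Q"
    using card_mono[of ?Q ?Z] by auto
  then obtain z where "z \<in> ?Z" "z \<notin> ?Q"
    by blast
  then have z: "z \<in> zero_ending" "length z = Suc n" "z \<notin> ?Q"
    by auto
  have "(step M F ?x ^^ ?t) init_config = (step M (insert z F) ?x ^^ ?t) init_config"
    using z(3) by (intro run_cong) auto
  then have same: "outputs_within M F ?x ?t y \<longleftrightarrow> outputs_within M (insert z F) ?x ?t y" for y
    by (simp add: outputs_within_def)
  have "length w < length z" if "w \<in> F" for w
    using F(2)[OF that] n(1) z(2) by simp
  then have "flip_census (insert z F) (Suc n) \<noteq> flip_census F (Suc n)"
    using flip_census_insert[of F z] z by simp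
  then have "binary (flip_census (insert z F) (Suc n)) \<noteq> binary (flip_census F (Suc n))"
    using inj_binary by (simp add: inj_eq)
  \<comment> \<open>The runs coincide while the required outputs differ, so at least one of
    \<open>F\<close> and \<open>insert z F\<close> defeats the machine.\<close>
  then have "\<not> outputs_within M F ?x ?t (binary (flip_census F (Suc n))) \<or>
      \<not> outputs_within M (insert z F) ?x ?t (binary (flip_census (insert z F) (Suc n)))"
    using same outputs_within_unique by blast
  then show ?thesis
  proof
    assume "\<not> outputs_within M F ?x ?t (binary (flip_census F (Suc n)))"
    with F n(1) show ?thesis
      by (intro that[of F "Suc n"]) (auto intro: le_SucI order_trans)
  next
    assume "\<not> outputs_within M (insert z F) ?x ?t (binary (flip_census (insert z F) (Suc n)))"
    with F n(1) z(1,2) show ?thesis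
      by (intro that[of "insert z F" "Suc n"]) (auto intro: le_SucI order_trans)
  qed
qed

text \<open>A condition \<open>(F, m)\<close> fixes the oracle on all strings of length at most \<open>m\<close>.\<close>

definition condition :: "bool list set \<times> nat \<Rightarrow> bool" where
  "condition c \<longleftrightarrow> fst c \<subseteq> zero_ending \<and> (\<forall>w\<in>fst c. length w \<le> snd c)"

definition extends :: "bool list set \<Rightarrow> bool list set \<times> nat \<Rightarrow> bool" where
  "extends A c \<longleftrightarrow> A \<subseteq> zero_ending \<and> (\<forall>w. length w \<le> snd c \<longrightarrow> (w \<in> A \<longleftrightarrow> w \<in> fst c))"

definition computes_census :: "transducer \<times> nat poly \<Rightarrow> bool list set \<Rightarrow> bool" where
  "computes_census = (\<lambda>(M, p) A. \<forall>n. outputs_within M A (unary n) (poly p n) (binary (flip_census A n)))"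

lemma extend_condition:
  assumes "condition c"
  obtains c' where "condition c'" "extends (fst c') c" "snd c \<le> snd c'"
    "\<And>A. extends A c' \<Longrightarrow> \<not> computes_census e A"
proof -
  obtain M p where e: "e = (M, p)" by fastforce
  obtain F m where c: "c = (F, m)" by fastforce
  obtain F' n where F': "F \<subseteq> F'" "F' \<subseteq> zero_ending" "\<And>w. w \<in> F' \<Longrightarrow> w \<in> F \<or> length w > m"
    "\<And>w. w \<in> F' \<Longrightarrow> length w \<le> n"
    "\<not> outputs_within M F' (unary n) (poly p n) (binary (flip_census F' n))"
    using defeat_machine[of F m M p] assms unfolding condition_def c by auto
  \<comment> \<open>Freezing lengths up to \<open>n\<close> preserves the census at \<open>n\<close>
    and up to \<open>poly p n\<close> preserves the run; \<open>m\<close> keeps the bounds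
    monotone.\<close>
  define k where "k = max m (max n (poly p n))"
  have "\<not> computes_census e A" if A: "extends A (F', k)" for A
  proof -
    have eq: "w \<in> A \<longleftrightarrow> w \<in> F'" if "length w \<le> k" for w
      using A that by (simp add: extends_def)
    have "flip_census A n = flip_census F' n"
      by (rule flip_census_local) (simp add: eq k_def)
    moreover have "outputs_within M A (unary n) (poly p n) y \<longleftrightarrow>
        outputs_within M F' (unary n) (poly p n) y" for y
      by (rule outputs_within_local) (simp add: eq k_def)
    ultimately show ?thesis
      using F'(5) unfolding e computes_census_def case_prod_conv by metis
  qed
  moreover have "condition (F', k)"
    using F'(2,4) by (fastforce simp: condition_def k_def)
  moreover have "extends F' (F, m)"
    using F'(1-3) by (fastforce simp: extends_def)
  ultimately show ?thesis
    using c by (intro that[of "(F', k)"]) (auto simp: k_def)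
qed

text \<open>Stage \<open>i\<close> reaches a condition all of whose extensions defeat
  \<open>e i\<close>. Later stages respect what is fixed, so the union of the conditions extends
  each of them.\<close>

lemma generic_oracle:
  fixes e :: "nat \<Rightarrow> transducer \<times> nat poly"
  obtains A where "A \<subseteq> zero_ending" "\<And>i. \<not> computes_census (e i) A"
proof -
  have "\<exists>c. \<forall>i. condition (c i) \<and> (extends (fst (c (Suc i))) (c i) \<and>
    snd (c i) \<le> snd (c (Suc i)) \<and> (\<forall>A. extends A (c (Suc i)) \<longrightarrow> \<not> computes_census (e i) A))"
  proof (rule dependent_nat_choice)
    show "\<exists>c. condition c"
      by (rule exI[of _ "({}, 0)"]) (simp add: condition_def)
    show "\<exists>c'. condition c' \<and> extends (fst c') c \<and> snd c \<le> snd c' \<and>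
        (\<forall>A. extends A c' \<longrightarrow> \<not> computes_census (e i) A)" if c: "condition c" for c i
      by (rule extend_condition[OF c, of "e i"]) blast
  qed
  then obtain c where c: "\<And>i. condition (c i)" "\<And>i. extends (fst (c (Suc i))) (c i)"
    "\<And>i. snd (c i) \<le> snd (c (Suc i))" "\<And>i A. extends A (c (Suc i)) \<Longrightarrow> \<not> computes_census (e i) A"
    by blast
  have mono: "snd (c i) \<le> snd (c j)" if "i \<le> j" for i j
    using c(3) that by (rule lift_Suc_mono_le)
  have stable: "w \<in> fst (c j) \<longleftrightarrow> w \<in> fst (c i)" if "i \<le> j" "length w \<le> snd (c i)" for w i j
    using that(1)
  proof (induction rule: dec_induct)
    case (step j)
    then have "length w \<le> snd (c j)"
      using mono[of i j] that(2) by simp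
    then show ?case
      using c(2)[of j] step.IH by (simp add: extends_def)
  qed simp
  define A where "A = (\<Union>i. fst (c i))"
  have A: "A \<subseteq> zero_ending"
    using c(1) by (auto simp: A_def condition_def)
  have "extends A (c i)" for i
  proof -
    \<comment> \<open>For \<open>i \<le> j\<close> the length bound at the earlier stage is assumed;
      for \<open>j < i\<close> it holds because \<open>c j\<close> is a condition.\<close>
    have "w \<in> fst (c i)" if "length w \<le> snd (c i)" "w \<in> fst (c j)" for w j
    proof (cases "i \<le> j")
      case True
      then show ?thesis using stable that by blast
    next
      case False
      moreover have "length w \<le> snd (c j)"
        using c(1)[of j] that(2) by (simp add: condition_def)
      ultimately show ?thesis using stable[of j i w] that(2) by simp
    qed
    then show ?thesis
      using A by (auto simp: extends_def A_def)
  qed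
  then show ?thesis
    using c(4) A that by blast
qed

section \<open>Enumerating the clocked machines\<close>

instance dir :: countable by countable_datatype
instance instr :: countable by countable_datatype

lemma countable_clocked_transducers: "countable (UNIV :: (transducer \<times> nat poly) set)"
proof -
  have "countable (UNIV :: nat poly set)"
    by (rule countableI[of "to_nat \<circ> coeffs"]) (auto simp: inj_on_def coeffs_eq_iff)
  moreover have "countable (UNIV :: transducer set)"
    by simp
  ultimately show ?thesis
    by (metis UNIV_Times_UNIV countable_SIGMA)
qed

theorem theorem5p3:
  shows "\<exists>A B :: bool list set. scalable A B \<and> census B \<notin> FP A unary binary"
proof -
  obtain A where A: "A \<subseteq> zero_ending"
      "\<And>i. \<not> computes_census (from_nat_into (UNIV :: (transducer \<times> nat poly) set) i) A"
    using generic_oracle by blast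
  have "\<not> computes_census e A" for e
    using A(2) from_nat_into_surj[OF countable_clocked_transducers, of e] by auto
  \<comment> \<open>Since \<open>unary n\<close> has length \<open>n\<close>, the clock in
    \<open>FP\<close> is exactly \<open>poly p n\<close>.\<close>
  then have "flip_census A \<notin> FP A unary binary"
    by (auto simp: FP_def computes_census_def unary_def)
  then show ?thesis
    using scalable_vimage_flip[OF A(1)] by blast
qed

end
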